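(* Let $u:\mathbb{R}^2\to\mathbb{C}$ be the piecewise linear function $$u(x)=\sum_{j=1}^J(\alpha_j^Tx+\beta_j)\,1_{\Omega_j}(x),\qquad \alpha_j=(\alpha_{j1},\alpha_{j2})\in\mathbb{C}^2,\ \beta_j\in\mathbb{C},$$ where $\Omega_1,\dots,\Omega_J\subset[-1/2,1/2)^2$ are domains, and $u$ is expressed with the smallest number of characteristic functions such that the $\Omega_j$ are pairwise disjoint. Let $\Gamma=\bigcup_{j=1}^J\partial\Omega_j$ be the singularity set of $u$, and suppose that there are a finite, rectangular and symmetric index set $K\subset\mathbb{Z}^2$ and coefficients $a(k)\in\mathbb{C}$ ($k\in K$) such that $$\Gamma\subseteq\{x\in\mathbb{R}^2:\varphi(x)=0\},\qquad \varphi(x)=\sum_{k\in K}a(k)e^{-2\pi i k\cdot x}.$$ Then for some vector field $p=(p_1,p_2)$ we have $$\sum_{k\in K}\mathcal{F}(\nabla u-p)(\xi+k)\,a(k)=0,\qquad \sum_{k\in K}\mathcal{F}(\nabla_s p)(\xi+k)\,a(k)=0,\qquad \xi\in\mathbb{R}^2,$$ where the Fourier transform $\mathcal{F}$ is applied to each component of $\nabla u-p$ and of $\nabla_sp$.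
   Context: $1_{\Omega}$ is the characteristic function of $\Omega$. The Fourier transform is $\mathcal{F}(f)(\xi)=\int_{\mathbb{R}^2}f(x)e^{-2\pi i\xi\cdot x}\,dx$, understood in the sense of tempered distributions where necessary. All derivatives are in the sense of distributions: $\nabla u=(\partial_1u,\partial_2u)$, and the symmetric gradient of $p=(p_1,p_2)$ is $$\nabla_sp=\tfrac12(\nabla p+\nabla p^T)=\begin{pmatrix}\partial_1p_1&\tfrac12(\partial_2p_1+\partial_1p_2)\\ \tfrac12(\partial_2p_1+\partial_1p_2)&\partial_2p_2\end{pmatrix}.$$ *)

theory Defs
  imports "HOL-Analysis.Analysis"
begin

section \<open>Tempered distributions on Euclidean space\<close>

definition partial :: "'n::finite \<Rightarrow> (real^'n \<Rightarrow> complex) \<Rightarrow> real^'n \<Rightarrow> complex" where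
  "partial i f x = frechet_derivative f (at x) (axis i 1)"

primrec partials :: "'n::finite list \<Rightarrow> (real^'n \<Rightarrow> complex) \<Rightarrow> real^'n \<Rightarrow> complex" where
  "partials [] f = f"
| "partials (i # is) f = partial i (partials is f)"

definition schwartz :: "(real^'n::finite \<Rightarrow> complex) \<Rightarrow> bool" where
  "schwartz f \<longleftrightarrow>
     (\<forall>is. (\<forall>x. partials is f differentiable (at x)) \<and>
           (\<forall>m::nat. bounded (range (\<lambda>x. (1 + norm x) ^ m *\<^sub>R partials is f x))))"

text \<open>A distribution is a complex functional of which only the values at Schwartz functions
  matter. All distributions used below are obtained from integrable functions by means of
  the operations in this section, so that their linearity and continuity
  need not be carried along.\<close>

type_synonym 'n distr = "(real^'n \<Rightarrow> complex) \<Rightarrow> complex"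

definition distr_of :: "(real^'n::finite \<Rightarrow> complex) \<Rightarrow> 'n distr" where
  "distr_of f \<psi> = (LINT x|lborel. f x * \<psi> x)"

definition distr_diff :: "'n::finite distr \<Rightarrow> 'n distr \<Rightarrow> 'n distr" where
  "distr_diff S T \<psi> = S \<psi> - T \<psi>"

definition distr_deriv :: "'n::finite \<Rightarrow> 'n distr \<Rightarrow> 'n distr" where
  "distr_deriv i T \<psi> = - T (partial i \<psi>)"

definition fourier :: "(real^'n::finite \<Rightarrow> complex) \<Rightarrow> real^'n \<Rightarrow> complex" where
  "fourier f \<xi> = (LINT x|lborel. f x * exp (- 2 * of_real pi * \<i> * of_real (\<xi> \<bullet> x)))"

definition distr_fourier :: "'n::finite distr \<Rightarrow> 'n distr" where
  "distr_fourier T \<psi> = T (fourier \<psi>)"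

text \<open>The distribution \<open>T\<close> is the continuous function \<open>g\<close>, which is then determined by \<open>T\<close>. This
  is what gives a meaning to the values of the Fourier transform of a distribution
  at individual points.\<close>

definition distr_is_fun :: "'n::finite distr \<Rightarrow> (real^'n \<Rightarrow> complex) \<Rightarrow> bool" where
  "distr_is_fun T g \<longleftrightarrow>
     continuous_on UNIV g \<and>
     (\<forall>\<psi>. schwartz \<psi> \<longrightarrow> integrable lborel (\<lambda>x. g x * \<psi> x) \<and> T \<psi> = distr_of g \<psi>)"

definition sym_grad :: "(real^'n::finite \<Rightarrow> complex^'n) \<Rightarrow> 'n \<Rightarrow> 'n \<Rightarrow> 'n distr" where
  "sym_grad p i j \<psi> =
     (distr_deriv j (distr_of (\<lambda>x. p x $ i)) \<psi> + distr_deriv i (distr_of (\<lambda>x. p x $ j)) \<psi>) / 2"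


section \<open>Piecewise linear functions and trigonometric polynomials\<close>

definition pw_linear_rep ::
  "(real^2 \<Rightarrow> complex) \<Rightarrow> nat \<Rightarrow> (nat \<Rightarrow> complex^2) \<Rightarrow> (nat \<Rightarrow> complex) \<Rightarrow> (nat \<Rightarrow> (real^2) set) \<Rightarrow> bool"
where
  "pw_linear_rep u J \<alpha> \<beta> \<Omega> \<longleftrightarrow>
     1 \<le> J \<and>
     (\<forall>j\<in>{1..J}. open (\<Omega> j) \<and> connected (\<Omega> j) \<and> \<Omega> j \<noteq> {} \<and>
                 \<Omega> j \<subseteq> {x. \<forall>i. - 1/2 \<le> x $ i \<and> x $ i < 1/2}) \<and>
     (\<forall>j\<in>{1..J}. \<forall>l\<in>{1..J}. j \<noteq> l \<longrightarrow> \<Omega> j \<inter> \<Omega> l = {}) \<and>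
     (\<forall>x. u x = (\<Sum>j=1..J. ((\<Sum>i\<in>UNIV. \<alpha> j $ i * of_real (x $ i)) + \<beta> j) * indicator (\<Omega> j) x))"

definition minimal_pw_linear_rep ::
  "(real^2 \<Rightarrow> complex) \<Rightarrow> nat \<Rightarrow> (nat \<Rightarrow> complex^2) \<Rightarrow> (nat \<Rightarrow> complex) \<Rightarrow> (nat \<Rightarrow> (real^2) set) \<Rightarrow> bool"
where
  "minimal_pw_linear_rep u J \<alpha> \<beta> \<Omega> \<longleftrightarrow>
     pw_linear_rep u J \<alpha> \<beta> \<Omega> \<and>
     (\<forall>J' \<alpha>' \<beta>' \<Omega>'. pw_linear_rep u J' \<alpha>' \<beta>' \<Omega>' \<longrightarrow> J \<le> J')"

definition real_vec :: "int^'n \<Rightarrow> real^'n::finite" where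
  "real_vec k = (\<chi> i. of_int (k $ i))"

definition rectangular :: "(int^'n::finite) set \<Rightarrow> bool" where
  "rectangular K \<longleftrightarrow> (\<exists>l r. K = {k. \<forall>i. l $ i \<le> k $ i \<and> k $ i \<le> r $ i})"

definition trig_poly :: "(int^'n::finite) set \<Rightarrow> (int^'n \<Rightarrow> complex) \<Rightarrow> real^'n \<Rightarrow> complex" where
  "trig_poly K a x = (\<Sum>k\<in>K. a k * exp (- 2 * of_real pi * \<i> * of_real (real_vec k \<bullet> x)))"

end

theory Submission
  imports Defs "HOL-Probability.Sinc_Integral" "HOL-Probability.Characteristic_Functions"
begin

text \<open>
  Take \<open>p = \<Sum>\<^sub>j \<alpha>\<^sub>j 1\<^bsub>\<Omega>\<^sub>j\<^esub>\<close>. Moving the derivatives of the distributions onto the exponentials, the sums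
  in question become \<open>- \<integral>\<^bsub>\<Omega>\<^sub>j\<^esub> \<partial>\<^sub>i g\<close>, summed over \<open>j\<close>, where \<open>g\<close> is an affine function (constant
  in the case of \<open>p\<close>) times \<open>\<phi>(x) exp (-2\<pi>\<i> \<xi> \<bullet> x)\<close>. As \<open>g\<close> vanishes on \<open>\<partial>\<Omega>\<^sub>j\<close>, these integrals are
  \<open>0\<close>, whatever the regularity of the boundary: on every line parallel to the \<open>i\<close>-th axis,
  \<open>1\<^bsub>\<Omega>\<^sub>j\<^esub> g\<close> is a primitive of \<open>1\<^bsub>\<Omega>\<^sub>j\<^esub> \<partial>\<^sub>i g\<close>.
\<close>

section \<open>Integrals of derivatives over open sets\<close>

text \<open>Where the derivative is nonzero, a zero of \<open>g\<close> has a neighbourhood without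
  further zeros. So all points of the set are isolated, and on the line such a set is countable. The
  lemma later shows that an exceptional set is null.\<close>

lemma countable_simple_zeros:
  fixes g g' :: "real \<Rightarrow> 'b::real_normed_vector"
  assumes der: "\<And>t. (g has_vector_derivative g' t) (at t)"
  shows "countable {t. g t = 0 \<and> g' t \<noteq> 0}"
proof -
  define Z where "Z = {t. g t = 0 \<and> g' t \<noteq> 0}"
  have iso: "\<exists>T. open T \<and> t \<in> T \<and> T \<inter> Z \<subseteq> {t}" if "t \<in> Z" for t
  proof -
    have t: "g t = 0" "g' t \<noteq> 0" using that by (auto simp: Z_def)
    have "((\<lambda>s. norm (g s - g t - (s - t) *\<^sub>R g' t) / norm (s - t)) \<longlongrightarrow> 0) (at t)"
      using der[of t] by (simp add: has_vector_derivative_def has_derivative_iff_norm)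
    then have "\<forall>\<^sub>F s in at t. norm (g s - g t - (s - t) *\<^sub>R g' t) / norm (s - t) < norm (g' t)"
      using t by (intro order_tendstoD) auto
    then obtain T where T: "open T" "t \<in> T"
      "\<And>s. s \<in> T \<Longrightarrow> s \<noteq> t \<Longrightarrow> norm (g s - g t - (s - t) *\<^sub>R g' t) / norm (s - t) < norm (g' t)"
      unfolding eventually_at_topological by auto
    \<comment> \<open>At a zero \<open>s\<close> of \<open>g\<close> the quotient in
      \<open>T(3)\<close> would be exactly \<open>norm (g' t)\<close>.\<close>
    have "g s \<noteq> 0" if "s \<in> T" "s \<noteq> t" for s
      using T(3)[OF that] t that by (auto simp: norm_minus_commute)
    with T(1,2) have "open T" "t \<in> T" "\<And>s. s \<in> T \<Longrightarrow> s \<noteq> t \<Longrightarrow> g s \<noteq> 0"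
      by auto
    then show ?thesis by (intro exI[of _ T]) (auto simp: Z_def)
  qed
  then obtain T where T: "\<And>t. t \<in> Z \<Longrightarrow> open (T t) \<and> t \<in> T t \<and> T t \<inter> Z \<subseteq> {t}"
    using bchoice[of Z "\<lambda>t T. open T \<and> t \<in> T \<and> T \<inter> Z \<subseteq> {t}"] by blast
  \<comment> \<open>By the Lindelof property countably many of the sets \<open>T t\<close> cover
    \<open>Z\<close>, and each contains at most one point of \<open>Z\<close>.\<close>
  obtain F where F: "F \<subseteq> T ` Z" "countable F" "\<Union>F = \<Union>(T ` Z)"
    using Lindelof[of "T ` Z"] T by blast
  have "Z \<subseteq> (\<Union>X\<in>F. X \<inter> Z)"
    using F(3) T by blast
  moreover have "countable (X \<inter> Z)" if "X \<in> F" for X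
  proof -
    obtain t where "t \<in> Z" "X = T t" using F(1) \<open>X \<in> F\<close> by blast
    then have "X \<inter> Z \<subseteq> {t}" using T by blast
    then show ?thesis by (rule countable_subset) simp
  qed
  then have "countable (\<Union>X\<in>F. X \<inter> Z)"
    using F(2) by blast
  ultimately show ?thesis
    unfolding Z_def[symmetric] by (rule countable_subset)
qed

text \<open>Off the frontier the indicator is locally constant. At a frontier point
  \<open>w s\<close> is \<open>o(s - t)\<close>, and cutting off can only decrease its norm, so the
  derivative there is \<open>0\<close> however irregular \<open>U\<close> is.\<close>

lemma has_vector_derivative_indicator:
  fixes w w' :: "real \<Rightarrow> 'b::real_normed_vector"
  assumes U: "open U" and der: "(w has_vector_derivative w' t) (at t)"
    and zero: "t \<in> frontier U \<Longrightarrow> w t = 0 \<and> w' t = 0"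
  shows "((\<lambda>s. indicator U s *\<^sub>R w s) has_vector_derivative indicator U t *\<^sub>R w' t) (at t)"
proof -
  consider "t \<in> U" | "t \<in> - closure U" | "t \<in> frontier U"
    using U by (auto simp: frontier_def interior_open)
  then show ?thesis
  proof cases
    case 1
    have "(w has_vector_derivative w' t) (at t) =
      ((\<lambda>s. indicator U s *\<^sub>R w s) has_vector_derivative w' t) (at t)"
      by (rule has_vector_derivative_cong_ev)
         (use 1 U eventually_nhds_in_open[of U t] in \<open>auto elim!: eventually_mono\<close>)
    then show ?thesis using der 1 by simp
  next
    case 2
    have "t \<notin> U" using 2 closure_subset by blast
    have "((\<lambda>s. indicator U s *\<^sub>R w s) has_vector_derivative 0) (at t)"
      by (rule has_vector_derivative_transform_within_open[where f = "\<lambda>_. 0" and S = "- closure U"])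
         (use 2 closure_subset[of U] in \<open>auto simp: indicator_def\<close>)
    then show ?thesis using \<open>t \<notin> U\<close> by simp
  next
    case 3
    then have "t \<notin> U" using U by (auto simp: frontier_def interior_open)
    have w0: "w t = 0" "w' t = 0" using zero 3 by auto
    have "((\<lambda>s. norm (w s) / norm (s - t)) \<longlongrightarrow> 0) (at t)"
      using der w0 by (simp add: has_vector_derivative_def has_derivative_iff_norm)
    then have "((\<lambda>s. norm (indicator U s *\<^sub>R w s) / norm (s - t)) \<longlongrightarrow> 0) (at t)"
      by (rule Lim_null_comparison[rotated])
         (auto intro!: always_eventually divide_right_mono simp: indicator_def)
    then show ?thesis
      using \<open>t \<notin> U\<close> by (simp add: has_vector_derivative_def has_derivative_iff_norm)
  qed
qed

text \<open>The boundary of \<open>U\<close> may have positive measure, and \<open>1\<^bsub>U\<^esub> g\<close> fails to be differentiable at the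
  boundary points with \<open>g' \<noteq> 0\<close>. The proof replaces \<open>g\<close> by \<open>w = g |g|\<^sup>2 / (e + |g|\<^sup>2)\<close>, the derivative of
  which vanishes with \<open>g\<close> and is bounded by \<open>2 |g'|\<close>, and lets \<open>e\<close> tend to \<open>0\<close>.\<close>

lemma has_integral_indicator_derivative:
  fixes g g' :: "real \<Rightarrow> 'b::euclidean_space"
  assumes U: "open U" and der: "\<And>t. (g has_vector_derivative g' t) (at t)"
    and cont: "continuous_on UNIV g'" and zero: "\<And>t. t \<in> frontier U \<Longrightarrow> g t = 0" and "a \<le> b"
  shows "((\<lambda>t. indicator U t *\<^sub>R g' t) has_integral indicator U b *\<^sub>R g b - indicator U a *\<^sub>R g a) {a..b}"
proof -
  define r where "r t = g t \<bullet> g t" for t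
  define w where "w e t = (r t / (e + r t)) *\<^sub>R g t" for e t
  define w' where "w' e t = (r t / (e + r t)) *\<^sub>R g' t + (2 * e * (g t \<bullet> g' t) / (e + r t)^2) *\<^sub>R g t" for e t
  have r0: "r t \<ge> 0" for t by (simp add: r_def)
  have derw: "(w e has_vector_derivative w' e t) (at t)" if "e > 0" for e t
  proof -
    have "(r has_real_derivative 2 * (g t \<bullet> g' t)) (at t)"
      unfolding r_def has_real_derivative_iff_has_vector_derivative has_vector_derivative_def
      using der[of t, unfolded has_vector_derivative_def]
      by (auto intro!: derivative_eq_intros simp: inner_commute algebra_simps)
    moreover have "e + r t \<noteq> 0" using r0[of t] that by linarith
    ultimately have "((\<lambda>t. r t / (e + r t)) has_real_derivative 2 * e * (g t \<bullet> g' t) / (e + r t)^2) (at t)"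
      by (auto intro!: derivative_eq_intros simp: field_simps power2_eq_square)
    then show ?thesis
      unfolding w_def[abs_def] w'_def using der[of t]
      by (intro has_vector_derivative_scaleR)
  qed
  \<comment> \<open>Both summands of \<open>w'\<close> are at most \<open>norm (g' t)\<close>, the
    second by the Cauchy-Schwarz inequality and \<open>2 * e * r t \<le> (e + r t)^2\<close>. The
    bound is independent of \<open>e\<close> and so serves as dominating function for the
    limit.\<close>
  have bound: "norm (w' e t) \<le> 2 * norm (g' t)" if "e > 0" for e t
  proof -
    have pos: "e + r t > 0" using r0[of t] that by linarith
    have "norm ((r t / (e + r t)) *\<^sub>R g' t) \<le> 1 * norm (g' t)"
      unfolding norm_scaleR using that r0[of t] pos by (intro mult_right_mono) auto
    moreover have "norm ((2 * e * (g t \<bullet> g' t) / (e + r t)^2) *\<^sub>R g t) \<le> norm (g' t)"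
    proof -
      have "norm ((2 * e * (g t \<bullet> g' t) / (e + r t)^2) *\<^sub>R g t) =
         2 * e * \<bar>g t \<bullet> g' t\<bar> * norm (g t) / (e + r t)^2"
        using that by (simp add: abs_mult)
      also have "\<dots> \<le> 2 * e * (norm (g t) * norm (g' t)) * norm (g t) / (e + r t)^2"
        using that by (intro divide_right_mono mult_right_mono mult_left_mono Cauchy_Schwarz_ineq2) auto
      also have "\<dots> = (2 * e * r t / (e + r t)^2) * norm (g' t)"
        by (simp add: r_def power2_norm_eq_inner[symmetric] power2_eq_square)
      also have "\<dots> \<le> 1 * norm (g' t)"
        proof (rule mult_right_mono)
        have "2 * e * r t \<le> (e + r t)^2" by (simp add: power2_sum)
        then show "2 * e * r t / (e + r t)^2 \<le> 1"
          using pos by (simp add: divide_le_eq_1)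
      qed simp
      finally show ?thesis by simp
    qed
    ultimately show ?thesis
      unfolding w'_def by (intro norm_triangle_le) linarith
  qed
  define e where "e n = inverse (real (Suc n))" for n
  have e: "e n > 0" "e \<longlonglongrightarrow> 0" for n
    unfolding e_def using LIMSEQ_inverse_real_of_nat by auto
  let ?h = "\<lambda>n t. indicator U t *\<^sub>R w (e n) t"
  let ?h' = "\<lambda>n t. indicator U t *\<^sub>R w' (e n) t"
  \<comment> \<open>At zeros of \<open>g\<close> all \<open>w'\<close> vanish, so the pointwise
    limit is \<open>0\<close> there instead of \<open>g'\<close>. Hence \<open>?G\<close> differs
    from the desired integrand at most at the zeros of \<open>g\<close> with
    \<open>g' t \<noteq> 0\<close>, which are countably many.\<close>
  let ?G = "\<lambda>t. if g t = 0 then 0 else indicator U t *\<^sub>R g' t"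
  have FTC: "(?h' n has_integral ?h n b - ?h n a) {a..b}" for n
  proof (rule fundamental_theorem_of_calculus[OF \<open>a \<le> b\<close>])
    fix t
    show "(?h n has_vector_derivative ?h' n t) (at t within {a..b})"
      by (rule has_vector_derivative_at_within, rule has_vector_derivative_indicator[OF U], rule derw[OF e(1)])
         (auto simp: w_def w'_def r_def dest!: zero)
  qed
  have lim_w: "(\<lambda>n. w (e n) t) \<longlonglongrightarrow> g t" for t
  proof (cases "g t = 0")
    case False
    then have "r t \<noteq> 0" by (simp add: r_def)
    then have "(\<lambda>n. w (e n) t) \<longlonglongrightarrow> (r t / (0 + r t)) *\<^sub>R g t"
      unfolding w_def by (intro tendsto_intros e) auto
    then show ?thesis using \<open>r t \<noteq> 0\<close> by simp
  qed (simp add: w_def)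
  have lim_w': "(\<lambda>n. ?h' n t) \<longlonglongrightarrow> ?G t" for t
  proof (cases "g t = 0")
    case False
    then have "r t \<noteq> 0" by (simp add: r_def)
    then have "(\<lambda>n. ?h' n t) \<longlonglongrightarrow> indicator U t *\<^sub>R
       ((r t / (0 + r t)) *\<^sub>R g' t + (2 * 0 * (g t \<bullet> g' t) / (0 + r t)^2) *\<^sub>R g t)"
      unfolding w'_def by (intro tendsto_intros e) auto
    then show ?thesis using \<open>r t \<noteq> 0\<close> False by simp
  qed (simp add: w'_def r_def)
  have dom: "?G integrable_on {a..b}" "(\<lambda>n. integral {a..b} (?h' n)) \<longlonglongrightarrow> integral {a..b} ?G"
  proof -
    have h: "(\<lambda>t. 2 * norm (g' t)) integrable_on {a..b}"
      by (intro integrable_continuous_real continuous_intros continuous_on_subset[OF cont]) auto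
    have le: "norm (?h' n t) \<le> 2 * norm (g' t)" for n t
      using bound[OF e(1), of n t] by (auto simp: indicator_def)
    have int: "?h' n integrable_on {a..b}" for n
      using FTC by blast
    show "?G integrable_on {a..b}"
      by (rule dominated_convergence(1)[where f = ?h', OF int h le lim_w'])
    show "(\<lambda>n. integral {a..b} (?h' n)) \<longlonglongrightarrow> integral {a..b} ?G"
      by (rule dominated_convergence(2)[where f = ?h', OF int h le lim_w'])
  qed
  have "(\<lambda>n. ?h n b - ?h n a) \<longlonglongrightarrow> integral {a..b} ?G"
    using dom(2) unfolding integral_unique[OF FTC] .
  moreover have "(\<lambda>n. ?h n b - ?h n a) \<longlonglongrightarrow> indicator U b *\<^sub>R g b - indicator U a *\<^sub>R g a"
    by (intro tendsto_intros lim_w)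
  ultimately have "integral {a..b} ?G = indicator U b *\<^sub>R g b - indicator U a *\<^sub>R g a"
    by (rule LIMSEQ_unique)
  with dom(1) have "(?G has_integral indicator U b *\<^sub>R g b - indicator U a *\<^sub>R g a) {a..b}"
    by (simp add: has_integral_iff)
  moreover have "negligible {t. g t = 0 \<and> g' t \<noteq> 0}"
    unfolding negligible_iff_null_sets
    by (intro null_sets_completionI countable_imp_null_set_lborel countable_simple_zeros der)
  ultimately show ?thesis
    by (rule has_integral_spike[rotated 2]) auto
qed

section \<open>From integrals along lines to integrals over the whole space\<close>

lemma has_bochner_integral_lborel_translate:
  fixes f :: "'a::euclidean_space \<Rightarrow> 'b::{banach,second_countable_topology}"
  assumes "has_bochner_integral lborel f I"
  shows "has_bochner_integral lborel (\<lambda>x. f (x + c)) I"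
proof -
  have [measurable]: "f \<in> borel_measurable borel"
    using assms by (auto simp: has_bochner_integral_iff)
  have "has_bochner_integral (distr lborel borel ((+) c)) f I"
    using assms by (simp add: lborel_distr_plus)
  then have "has_bochner_integral lborel (\<lambda>x. f (c + x)) I"
    by (simp add: has_bochner_integral_iff integrable_distr_eq integral_distr)
  then show ?thesis
    by (simp add: add.commute)
qed

text \<open>The integral of \<open>f\<close> over the segment from \<open>x\<close> to
  \<open>x + v\<close> is \<open>h (x + v) - h x\<close> by the one-dimensional result, and the
  integral of this difference over all \<open>x\<close> vanishes because Lebesgue measure is
  translation invariant. Averaging over translates along \<open>v\<close> replaces a splitting of
  the space into a line and its complement, so any direction is treated alike.\<close>

lemma lborel_integral_indicator_derivative_eq_0:
  fixes g D :: "'a::euclidean_space \<Rightarrow> 'b::euclidean_space"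
  assumes \<Omega>: "open \<Omega>"
    and der: "\<And>x. ((\<lambda>t. g (x + t *\<^sub>R v)) has_vector_derivative D x) (at 0)"
    and cont: "continuous_on UNIV D"
    and g: "integrable lborel (\<lambda>x. indicator \<Omega> x *\<^sub>R g x)"
    and D: "integrable lborel (\<lambda>x. indicator \<Omega> x *\<^sub>R D x)"
    and zero: "\<And>x. x \<in> frontier \<Omega> \<Longrightarrow> g x = 0"
  shows "(LINT x|lborel. indicator \<Omega> x *\<^sub>R D x) = 0"
proof -
  define f where "f x = indicator \<Omega> x *\<^sub>R D x" for x
  define h where "h x = indicator \<Omega> x *\<^sub>R g x" for x
  \<comment> \<open>The cutoff to \<open>0 \<le> t \<le> 1\<close> makes \<open>F\<close> integrable
    on the product space: each of these \<open>t\<close> contributes the same integral of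
    \<open>norm (f x)\<close>.\<close>
  define F where "F t x = indicator {0..1::real} t *\<^sub>R f (x + t *\<^sub>R v)" for t x
  have [measurable]: "f \<in> borel_measurable borel"
    using D by (simp add: f_def[abs_def])
  have f: "has_bochner_integral lborel f (integral\<^sup>L lborel f)"
    and h: "has_bochner_integral lborel h (integral\<^sup>L lborel h)"
    using D g by (auto simp: f_def[abs_def] h_def[abs_def] has_bochner_integral_integrable)
  note ft = has_bochner_integral_lborel_translate[OF f]
  note ht = has_bochner_integral_lborel_translate[OF h]
  have nf: "has_bochner_integral lborel (\<lambda>x. norm (f (x + c))) (LINT x|lborel. norm (f x))" for c
    by (rule has_bochner_integral_lborel_translate)
       (use f in \<open>simp add: has_bochner_integral_iff integrable_norm\<close>)
  have line: "((\<lambda>t. f (x + t *\<^sub>R v)) has_integral h (x + v) - h x) {0..1}" for x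
  proof -
    let ?U = "(\<lambda>t. x + t *\<^sub>R v) -` \<Omega>"
    have U: "open ?U"
      by (intro continuous_open_vimage \<Omega> continuous_intros)
    have fr: "x + t *\<^sub>R v \<in> frontier \<Omega>" if "t \<in> frontier ?U" for t
    proof -
      have "t \<in> closure ?U" "x + t *\<^sub>R v \<notin> \<Omega>"
        using that U by (auto simp: frontier_def interior_open)
      moreover have "closure ?U \<subseteq> (\<lambda>t. x + t *\<^sub>R v) -` closure \<Omega>"
        by (rule closure_minimal) (use closure_subset in \<open>auto intro!: continuous_closed_vimage continuous_intros\<close>)
      ultimately show ?thesis using \<Omega> by (auto simp: frontier_def interior_open)
    qed
    have der': "((\<lambda>t. g (x + t *\<^sub>R v)) has_vector_derivative D (x + t *\<^sub>R v)) (at t)" for t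
    proof -
      have "(((\<lambda>s. g ((x + t *\<^sub>R v) + s *\<^sub>R v)) \<circ> (\<lambda>s. s - t)) has_vector_derivative 1 *\<^sub>R D (x + t *\<^sub>R v)) (at t)"
        by (rule vector_diff_chain_at) (use der[of "x + t *\<^sub>R v"] in \<open>auto intro!: derivative_eq_intros\<close>)
      then show ?thesis by (simp add: o_def algebra_simps)
    qed
    have "((\<lambda>t. indicator ?U t *\<^sub>R D (x + t *\<^sub>R v)) has_integral
       indicator ?U 1 *\<^sub>R g (x + 1 *\<^sub>R v) - indicator ?U 0 *\<^sub>R g (x + 0 *\<^sub>R v)) {0..1}"
      by (rule has_integral_indicator_derivative[OF U der'])
         (auto intro!: zero fr continuous_on_compose2[OF cont] continuous_intros)
    then show ?thesis
      by (simp add: f_def h_def indicator_def)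
  qed
  \<comment> \<open>By translation invariance, \<open>\<integral> f\<close> is the mean over \<open>t \<in> [0,1]\<close> of \<open>\<integral> f (x + t v) dx\<close>.\<close>
  have F: "integrable (lborel \<Otimes>\<^sub>M lborel) (case_prod F)"
  proof (rule lborel_pair.Fubini_integrable)
    show "case_prod F \<in> borel_measurable (lborel \<Otimes>\<^sub>M lborel)"
      unfolding F_def by measurable
    have "(LINT x|lborel. norm (F t x)) = indicator {0..1} t *\<^sub>R (LINT x|lborel. norm (f x))" for t
      using nf[of "t *\<^sub>R v"] by (simp add: F_def has_bochner_integral_iff)
    then show "integrable lborel (\<lambda>t. LINT x|lborel. norm (case_prod F (t, x)))"
      by simp
    show "AE t in lborel. integrable lborel (\<lambda>x. case_prod F (t, x))"
      using ft by (auto simp: F_def has_bochner_integral_iff)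
  qed
  have "integral\<^sup>L lborel f = (LINT t|lborel. indicator {0..1::real} t *\<^sub>R integral\<^sup>L lborel f)"
    by simp
  also have "\<dots> = (LINT t|lborel. LINT x|lborel. F t x)"
    using ft by (auto simp: F_def has_bochner_integral_iff)
  also have "\<dots> = (LINT x|lborel. LINT t|lborel. F t x)"
    using lborel_pair.Fubini_integral[OF F] by simp
  also have "\<dots> = (LINT x|lborel. h (x + v) - h x)"
  proof (rule integral_cong_AE)
    \<comment> \<open>The fact \<open>line\<close> concerns the gauge integral. For almost every
      \<open>x\<close> Fubini supplies the Lebesgue integrability under which the two integrals
      agree.\<close>
    show "AE x in lborel. (LINT t|lborel. F t x) = h (x + v) - h x"
      using lborel_pair.AE_integrable_snd[OF F]
    proof eventually_elim
      case (elim x)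
      then have "set_integrable lborel {0..1} (\<lambda>t. f (x + t *\<^sub>R v))"
        by (simp add: F_def set_integrable_def)
      from set_borel_integral_eq_integral(2)[OF this] integral_unique[OF line[of x]]
      show ?case by (simp add: F_def set_lebesgue_integral_def)
    qed
    show "(\<lambda>x. LINT t|lborel. F t x) \<in> borel_measurable lborel"
      using lborel_pair.integrable_snd[OF F] by simp
    show "(\<lambda>x. h (x + v) - h x) \<in> borel_measurable lborel"
      using ht[of v] ht[of 0] by (auto simp: has_bochner_integral_iff)
  qed
  also have "\<dots> = 0"
    using ht[of v] ht[of 0] by (auto simp: has_bochner_integral_iff)
  finally show ?thesis by (simp add: f_def[abs_def])
qed

section \<open>The Fourier transform of integrable functions\<close>

text \<open>The common kernel of \<open>fourier\<close> and \<open>trig_poly\<close>. Shifting the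
  frequency by \<open>k\<close> multiplies it by the \<open>k\<close>-th exponential, which is how
  the sums over \<open>K\<close> will produce the trigonometric polynomial.\<close>

definition char_exp :: "real^'n::finite \<Rightarrow> real^'n \<Rightarrow> complex" where
  "char_exp \<xi> x = exp (- 2 * of_real pi * \<i> * of_real (\<xi> \<bullet> x))"

lemma norm_char_exp [simp]: "norm (char_exp \<xi> x) = 1"
  by (simp add: char_exp_def)

lemma continuous_on_char_exp [continuous_intros]:
  assumes "continuous_on S f" "continuous_on S g"
  shows "continuous_on S (\<lambda>x. char_exp (f x) (g x))"
  unfolding char_exp_def by (intro continuous_intros assms)

lemma char_exp_commute: "char_exp \<xi> x = char_exp x \<xi>"
  by (simp add: char_exp_def inner_commute)

lemma char_exp_add: "char_exp (\<xi> + \<eta>) x = char_exp \<xi> x * char_exp \<eta> x"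
  by (simp add: char_exp_def inner_add_left algebra_simps flip: exp_add)

lemma borel_measurable_char_exp [measurable]:
  assumes [measurable]: "f \<in> borel_measurable M" "g \<in> borel_measurable M"
  shows "(\<lambda>x. char_exp (f x) (g x)) \<in> borel_measurable M"
  unfolding char_exp_def
  by (intro borel_measurable_continuous_on[OF continuous_on_exp[OF continuous_on_id]]) measurable

lemma fourier_eq: "fourier f \<xi> = (LINT x|lborel. f x * char_exp \<xi> x)"
  by (simp add: fourier_def char_exp_def)

lemma trig_poly_eq: "trig_poly K a x = (\<Sum>k\<in>K. a k * char_exp (real_vec k) x)"
  by (simp add: trig_poly_def char_exp_def)

lemma integrable_times_char_exp:
  assumes "integrable lborel f"
  shows "integrable lborel (\<lambda>x. f x * char_exp \<xi> x)"
  using assms by (rule Bochner_Integration.integrable_bound)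
    (use assms in \<open>auto simp: norm_mult\<close>)

text \<open>Continuity is what lets \<open>distr_is_fun\<close> give meaning to values at single
  points. It follows by dominated convergence, as the exponentials have modulus 1.\<close>

lemma continuous_on_fourier:
  assumes "integrable lborel f"
  shows "continuous_on UNIV (fourier f)"
  unfolding fourier_eq
proof (rule continuous_at_imp_continuous_on, intro ballI)
  fix \<xi>
  show "isCont (\<lambda>\<xi>. LINT x|lborel. f x * char_exp \<xi> x) \<xi>"
    unfolding continuous_at_sequentially
  proof (intro allI impI)
    fix s assume s: "s \<longlonglongrightarrow> \<xi>"
    have "(\<lambda>n. LINT x|lborel. f x * char_exp (s n) x) \<longlonglongrightarrow> (LINT x|lborel. f x * char_exp \<xi> x)"
    proof (rule integral_dominated_convergence[where w = "\<lambda>x. norm (f x)"])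
      show "AE x in lborel. (\<lambda>n. f x * char_exp (s n) x) \<longlonglongrightarrow> f x * char_exp \<xi> x"
        unfolding char_exp_def by (intro AE_I2 tendsto_intros s)
    qed (use assms in \<open>auto simp: norm_mult\<close>)
    then show "((\<lambda>\<xi>. LINT x|lborel. f x * char_exp \<xi> x) \<circ> s) \<longlonglongrightarrow> (LINT x|lborel. f x * char_exp \<xi> x)"
      by (simp add: o_def)
  qed
qed

lemma norm_fourier_le:
  assumes "integrable lborel f"
  shows "norm (fourier f \<xi>) \<le> (LINT x|lborel. norm (f x))"
  unfolding fourier_eq
  by (rule integral_norm_bound[THEN order_trans]) (simp add: norm_mult)

lemma integrable_fourier_times:
  assumes "integrable lborel f" "integrable lborel g"
  shows "integrable lborel (\<lambda>\<xi>. fourier f \<xi> * g \<xi>)"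
proof (rule Bochner_Integration.integrable_bound)
  show "integrable lborel (\<lambda>\<xi>. (LINT x|lborel. norm (f x)) *\<^sub>R g \<xi>)"
    using assms(2) by simp
  have "fourier f \<in> borel_measurable borel"
    using continuous_on_fourier[OF assms(1)] by (rule borel_measurable_continuous_onI)
  then show "(\<lambda>\<xi>. fourier f \<xi> * g \<xi>) \<in> borel_measurable lborel"
    using assms(2) by auto
  show "AE \<xi> in lborel. norm (fourier f \<xi> * g \<xi>) \<le> norm ((LINT x|lborel. norm (f x)) *\<^sub>R g \<xi>)"
    by (auto simp: norm_mult intro!: mult_right_mono order_trans[OF norm_fourier_le[OF assms(1)]])
qed

text \<open>Fubini, since the kernel is symmetric in \<open>x\<close> and \<open>\<xi>\<close>. This
  identity takes the Fourier transform off the test function and thus links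
  \<open>distr_fourier\<close> with \<open>fourier\<close>.\<close>

lemma integral_times_fourier:
  assumes f: "integrable lborel f" and g: "integrable lborel g"
  shows "(LINT x|lborel. f x * fourier g x) = (LINT \<xi>|lborel. fourier f \<xi> * g \<xi>)"
proof -
  have [measurable]: "f \<in> borel_measurable borel" "g \<in> borel_measurable borel"
    using f g by auto
  let ?F = "\<lambda>x \<xi>. f x * (g \<xi> * char_exp x \<xi>)"
  have "integrable (lborel \<Otimes>\<^sub>M lborel) (case_prod ?F)"
  proof (rule lborel_pair.Fubini_integrable)
    show "case_prod ?F \<in> borel_measurable (lborel \<Otimes>\<^sub>M lborel)"
      by measurable
    show "integrable lborel (\<lambda>x. LINT \<xi>|lborel. norm (case_prod ?F (x, \<xi>)))"
      using f by (simp add: norm_mult)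
    show "AE x in lborel. integrable lborel (\<lambda>\<xi>. case_prod ?F (x, \<xi>))"
      using integrable_times_char_exp[OF g] by simp
  qed
  then have "(LINT \<xi>|lborel. LINT x|lborel. ?F x \<xi>) = (LINT x|lborel. LINT \<xi>|lborel. ?F x \<xi>)"
    by (rule lborel_pair.Fubini_integral)
  moreover have "(LINT x|lborel. ?F x \<xi>) = fourier f \<xi> * g \<xi>" for \<xi>
    by (simp add: fourier_eq char_exp_commute[of \<xi>] mult_ac flip: integral_mult_right_zero integral_mult_left_zero)
  moreover have "(LINT \<xi>|lborel. ?F x \<xi>) = f x * fourier g x" for x
    by (simp only: fourier_eq integral_mult_right_zero)
  ultimately show ?thesis by (simp only:)
qed

section \<open>Differentiation of Fourier transforms\<close>

lemma norm_exp_i_diff_le: "norm (exp (\<i> * of_real t) - 1 - \<i> * of_real t) \<le> t\<^sup>2 / 2"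
  using iexp_approx1[of t 1] by (simp add: power2_eq_square diff_diff_eq)

text \<open>As \<open>partial\<close> is defined by the total derivative, differentiability in one
  direction does not suffice. The exponential is expanded to first order in \<open>h\<close>, and
  the second moment of \<open>f\<close> bounds the remainder by a multiple of
  \<open>(norm h)\<^sup>2\<close>.\<close>

lemma partial_fourier:
  fixes f :: "real^'n::finite \<Rightarrow> complex"
  assumes f: "integrable lborel f" and f2: "integrable lborel (\<lambda>x. (norm x)\<^sup>2 *\<^sub>R f x)"
    and f1: "\<And>i. integrable lborel (\<lambda>x. of_real (x $ i) * f x)"
  shows "partial i (fourier f) \<xi> = fourier (\<lambda>x. - 2 * of_real pi * \<i> * (of_real (x $ i) * f x)) \<xi>"
proof -
  \<comment> \<open>The candidate for the total derivative. \<open>Leq\<close> gathers it into one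
    integral, so that the remainder can be estimated pointwise under the integral sign.\<close>
  define L where "L h = (\<Sum>i\<in>UNIV. of_real (h $ i) * fourier (\<lambda>x. - 2 * of_real pi * \<i> * (of_real (x $ i) * f x)) \<xi>)"
    for h :: "real^'n"
  have Leq: "L h = (LINT x|lborel. - 2 * of_real pi * \<i> * of_real (h \<bullet> x) * f x * char_exp \<xi> x)"
    and Lint: "integrable lborel (\<lambda>x. - 2 * of_real pi * \<i> * of_real (h \<bullet> x) * f x * char_exp \<xi> x)" for h
  proof -
    have int: "integrable lborel (\<lambda>x. of_real (h $ i) * (- 2 * of_real pi * \<i> * (of_real (x $ i) * f x) * char_exp \<xi> x))" for i
      by (intro integrable_mult_right integrable_times_char_exp f1)
    have eq: "(\<lambda>x. - 2 * of_real pi * \<i> * of_real (h \<bullet> x) * f x * char_exp \<xi> x) =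
      (\<lambda>x. \<Sum>i\<in>UNIV. of_real (h $ i) * (- 2 * of_real pi * \<i> * (of_real (x $ i) * f x) * char_exp \<xi> x))"
      by (simp add: inner_vec_def sum_distrib_left sum_distrib_right mult_ac)
    show "integrable lborel (\<lambda>x. - 2 * of_real pi * \<i> * of_real (h \<bullet> x) * f x * char_exp \<xi> x)"
      unfolding eq by (intro Bochner_Integration.integrable_sum int)
    show "L h = (LINT x|lborel. - 2 * of_real pi * \<i> * of_real (h \<bullet> x) * f x * char_exp \<xi> x)"
      unfolding eq L_def fourier_eq
      by (subst Bochner_Integration.integral_sum[OF int]) simp
  qed
  \<comment> \<open>The factor \<open>2 * pi\<^sup>2\<close> comes from \<open>t\<^sup>2 / 2\<close>
    with \<open>t = - 2 * pi * (h \<bullet> x)\<close>.\<close>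
  define C where "C = 2 * pi\<^sup>2 * (LINT x|lborel. norm ((norm x)\<^sup>2 *\<^sub>R f x))"
  have est: "norm (fourier f (\<xi> + h) - fourier f \<xi> - L h) \<le> C * (norm h)\<^sup>2" for h
  proof -
    have pw: "norm (f x * char_exp (\<xi> + h) x - f x * char_exp \<xi> x - (- 2 * of_real pi * \<i> * of_real (h \<bullet> x) * f x * char_exp \<xi> x))
       \<le> 2 * pi\<^sup>2 * (norm h)\<^sup>2 * norm ((norm x)\<^sup>2 *\<^sub>R f x)" for x
    proof -
      define t where "t = - 2 * pi * (h \<bullet> x)"
      have "f x * char_exp (\<xi> + h) x - f x * char_exp \<xi> x - (- 2 * of_real pi * \<i> * of_real (h \<bullet> x) * f x * char_exp \<xi> x)
        = f x * char_exp \<xi> x * (char_exp h x - 1 - (- 2 * of_real pi * \<i> * of_real (h \<bullet> x)))"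
        by (simp add: char_exp_add algebra_simps)
      also have "\<dots> = f x * char_exp \<xi> x * (exp (\<i> * of_real t) - 1 - \<i> * of_real t)"
        by (simp add: char_exp_def t_def mult_ac)
      also have "norm \<dots> \<le> norm (f x) * (t\<^sup>2 / 2)"
        unfolding norm_mult norm_char_exp mult_1_right
        by (intro mult_left_mono norm_exp_i_diff_le norm_ge_zero)
      also have "t\<^sup>2 / 2 = 2 * pi\<^sup>2 * (h \<bullet> x)\<^sup>2"
        by (simp add: t_def power_mult_distrib)
      also have "norm (f x) * \<dots> \<le> norm (f x) * (2 * pi\<^sup>2 * (norm h * norm x)\<^sup>2)"
        using Cauchy_Schwarz_ineq2[of h x]
        by (intro mult_left_mono) (auto simp: abs_le_square_iff[symmetric] abs_mult)
      finally show ?thesis by (simp add: power_mult_distrib mult_ac)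
    qed
    have "fourier f (\<xi> + h) - fourier f \<xi> - L h = (LINT x|lborel. f x * char_exp (\<xi> + h) x - f x * char_exp \<xi> x -
        (- 2 * of_real pi * \<i> * of_real (h \<bullet> x) * f x * char_exp \<xi> x))"
      unfolding Leq fourier_eq using integrable_times_char_exp[OF f] Lint by simp
    also have "norm \<dots> \<le> (LINT x|lborel. 2 * pi\<^sup>2 * (norm h)\<^sup>2 * norm ((norm x)\<^sup>2 *\<^sub>R f x))"
    proof (rule Bochner_Integration.integral_norm_bound_integral)
      show "integrable lborel (\<lambda>x. 2 * pi\<^sup>2 * (norm h)\<^sup>2 * norm ((norm x)\<^sup>2 *\<^sub>R f x))"
        using f2 by (intro integrable_mult_right integrable_norm)
    qed (use integrable_times_char_exp[OF f] Lint pw in \<open>auto intro!: Bochner_Integration.integrable_diff\<close>)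
    also have "\<dots> = C * (norm h)\<^sup>2"
      unfolding C_def integral_mult_right_zero by simp
    finally show ?thesis .
  qed
  have "(fourier f has_derivative L) (at \<xi>)"
    unfolding has_derivative_at
  proof
    show "bounded_linear L"
      unfolding L_def
      by (intro bounded_linear_sum bounded_linear_compose[OF bounded_linear_mult_left]
          bounded_linear_compose[OF bounded_linear_of_real] bounded_linear_vec_nth)
    have "((\<lambda>h. C * norm h) \<longlongrightarrow> 0) (at (0::real^'n))"
      by (rule tendsto_mult_right_zero[OF tendsto_norm_zero[OF tendsto_ident_at]])
    then show "(\<lambda>h. norm (fourier f (\<xi> + h) - fourier f \<xi> - L h) / norm h) \<midarrow>0\<rightarrow> 0"
      by (rule Lim_null_comparison[rotated])
         (use est in \<open>auto intro!: always_eventually simp: divide_le_eq power2_eq_square mult_ac\<close>)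
  qed
  then have "frechet_derivative (fourier f) (at \<xi>) = L"
    by (rule frechet_derivative_at[symmetric])
  moreover have "of_real (axis i (1::real) $ j) * w = (if j = i then w else 0)" for j and w :: complex
    by (simp add: axis_def)
  ultimately show ?thesis
    by (simp add: partial_def L_def)
qed

section \<open>Integrability of Schwartz functions\<close>

text \<open>The exponent gives two powers to each coordinate: \<open>(1 + norm x)\<^sup>2\<close>
  dominates \<open>1 + (x \<bullet> b)\<^sup>2\<close>, and the product over the coordinates of the
  integrable functions \<open>inverse (1 + t\<^sup>2)\<close> is integrable.\<close>

lemma integrable_inverse_norm_power:
  "integrable lborel (\<lambda>x::'a::euclidean_space. inverse ((1 + norm x) ^ (2 * DIM('a))))"
proof (rule Bochner_Integration.integrable_bound)
  have 1: "integrable lborel (\<lambda>x::real. inverse (1 + x\<^sup>2))"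
    using integrable_inverse_1_plus_square by (simp add: set_integrable_def einterval_def)
  interpret product_sigma_finite "\<lambda>_::'a. lborel :: real measure"
    by standard
  have "integrable (\<Pi>\<^sub>M b\<in>(Basis::'a set). lborel) (\<lambda>x. \<Prod>b\<in>Basis. inverse (1 + (x b :: real)\<^sup>2))"
    by (rule product_integrable_prod[where f = "\<lambda>_ t. inverse (1 + t\<^sup>2)"]) (auto intro: 1)
  then show "integrable lborel (\<lambda>x::'a. \<Prod>b\<in>Basis. inverse (1 + (x \<bullet> b)\<^sup>2))"
    by (subst lborel_eq, subst integrable_distr_eq) (auto cong: prod.cong)
  show "AE x::'a in lborel. norm (inverse ((1 + norm x) ^ (2 * DIM('a)))) \<le> norm (\<Prod>b\<in>Basis. inverse (1 + (x \<bullet> b)\<^sup>2))"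
  proof (rule AE_I2)
    fix x :: 'a
    have "inverse ((1 + norm x) ^ (2 * DIM('a))) = (\<Prod>b\<in>(Basis::'a set). inverse ((1 + norm x)\<^sup>2))"
      by (simp add: power_mult power_inverse)
    also have "\<dots> \<le> (\<Prod>b\<in>Basis. inverse (1 + (x \<bullet> b)\<^sup>2))"
    proof (rule prod_mono, intro conjI le_imp_inverse_le)
      fix b :: 'a assume "b \<in> Basis"
      then have "\<bar>x \<bullet> b\<bar> \<le> \<bar>norm x\<bar>" using Basis_le_norm by auto
      then have "(x \<bullet> b)\<^sup>2 \<le> (norm x)\<^sup>2" by (rule iffD1[OF abs_le_square_iff])
      then have "1 + (x \<bullet> b)\<^sup>2 \<le> 1 + (norm x)\<^sup>2" by simp
      also have "1 + (norm x)\<^sup>2 \<le> (1 + norm x)\<^sup>2" by (simp add: power2_sum)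
      finally show "1 + (x \<bullet> b)\<^sup>2 \<le> (1 + norm x)\<^sup>2" by simp
      show "0 < 1 + (x \<bullet> b)\<^sup>2" by (simp add: add_pos_nonneg)
    qed simp
    finally show "norm (inverse ((1 + norm x) ^ (2 * DIM('a)))) \<le> norm (\<Prod>b\<in>Basis. inverse (1 + (x \<bullet> b)\<^sup>2))"
      by (simp add: abs_of_nonneg prod_nonneg)
  qed
qed auto

text \<open>The decay of \<open>\<psi>\<close> is used with \<open>m + ?N\<close> powers:
  \<open>m\<close> of them absorb the growth of \<open>p\<close>, and the remaining
  \<open>?N\<close> leave the integrable weight of the preceding lemma.\<close>

lemma schwartz_integrable:
  fixes \<psi> :: "real^'n::finite \<Rightarrow> complex"
  assumes "schwartz \<psi>" and [measurable]: "p \<in> borel_measurable borel"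
    and p: "\<And>x. norm (p x) \<le> (1 + norm x) ^ m"
  shows "integrable lborel (\<lambda>x. p x * \<psi> x)"
proof -
  \<comment> \<open>The empty list of derivatives in \<open>schwartz\<close> stands for
    \<open>\<psi>\<close> itself.\<close>
  have diff: "\<psi> differentiable (at x)" for x
    using assms(1)[unfolded schwartz_def, rule_format, of "[]"] by auto
  have bdd: "bounded (range (\<lambda>x. (1 + norm x) ^ k *\<^sub>R \<psi> x))" for k
    using assms(1)[unfolded schwartz_def, rule_format, of "[]"] by auto
  have [measurable]: "\<psi> \<in> borel_measurable borel"
    by (intro borel_measurable_continuous_onI differentiable_imp_continuous_on)
       (simp add: differentiable_on_def diff differentiable_at_withinI)
  let ?N = "2 * DIM(real^'n)"
  obtain B where B: "\<And>x. norm ((1 + norm x) ^ (m + ?N) *\<^sub>R \<psi> x) \<le> B"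
    using bdd[of "m + ?N"] unfolding bounded_iff by blast
  show ?thesis
  proof (rule Bochner_Integration.integrable_bound)
    show "integrable lborel (\<lambda>x::real^'n. B * inverse ((1 + norm x) ^ ?N))"
      by (intro integrable_mult_right integrable_inverse_norm_power)
    show "AE x in lborel. norm (p x * \<psi> x) \<le> norm (B * inverse ((1 + norm x) ^ ?N))"
    proof (rule AE_I2)
      fix x :: "real^'n"
      have pos: "(1 + norm x) ^ ?N > 0" by (simp add: add_pos_nonneg)
      have "norm (p x * \<psi> x) \<le> (1 + norm x) ^ m * norm (\<psi> x)"
        by (simp add: norm_mult mult_right_mono p)
      also have "\<dots> * (1 + norm x) ^ ?N \<le> B"
        using B[of x] by (simp add: power_add mult_ac)
      then have "(1 + norm x) ^ m * norm (\<psi> x) \<le> B * inverse ((1 + norm x) ^ ?N)"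
        using pos by (simp add: field_simps)
      finally show "norm (p x * \<psi> x) \<le> norm (B * inverse ((1 + norm x) ^ ?N))"
        by simp
    qed
  qed auto
qed

section \<open>Fourier transforms of derivatives as continuous functions\<close>

lemma distr_is_fun_fourier:
  assumes f: "integrable lborel f"
  shows "distr_is_fun (distr_fourier (distr_of f)) (fourier f)"
  unfolding distr_is_fun_def
proof (intro conjI allI impI)
  fix \<psi> :: "real^'a \<Rightarrow> complex" assume "schwartz \<psi>"
  then have \<psi>: "integrable lborel \<psi>"
    using schwartz_integrable[of \<psi> "\<lambda>_. 1" 0] by simp
  show "integrable lborel (\<lambda>x. fourier f x * \<psi> x)"
    using f \<psi> by (rule integrable_fourier_times)
  show "distr_fourier (distr_of f) \<psi> = distr_of (fourier f) \<psi>"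
    by (simp add: distr_fourier_def distr_of_def integral_times_fourier[OF f \<psi>])
qed (rule continuous_on_fourier[OF f])

text \<open>The derivative falls on the Fourier transform of \<open>\<psi>\<close>, where it becomes
  multiplication of \<open>\<psi>\<close> by
  \<open>- 2 * of_real pi * \<i> * of_real (x $ i)\<close>; then
  \<open>integral_times_fourier\<close> moves the transform to \<open>f\<close>. The minus sign of
  \<open>distr_deriv\<close> cancels the one in this factor.\<close>

lemma distr_is_fun_fourier_deriv:
  fixes f :: "real^'n::finite \<Rightarrow> complex"
  assumes f: "integrable lborel f"
  shows "distr_is_fun (distr_fourier (distr_deriv i (distr_of f)))
           (\<lambda>\<xi>. 2 * of_real pi * \<i> * of_real (\<xi> $ i) * fourier f \<xi>)"
  unfolding distr_is_fun_def
proof (intro conjI allI impI)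
  show "continuous_on UNIV (\<lambda>\<xi>. 2 * of_real pi * \<i> * of_real (\<xi> $ i) * fourier f \<xi>)"
    by (intro continuous_intros continuous_on_fourier[OF f])
  fix \<psi> :: "real^'n \<Rightarrow> complex" assume S: "schwartz \<psi>"
  have \<psi>: "integrable lborel \<psi>"
    using schwartz_integrable[OF S, of "\<lambda>_. 1" 0] by simp
  have \<psi>1: "integrable lborel (\<lambda>x. of_real (x $ j) * \<psi> x)" for j
  proof (rule schwartz_integrable[OF S])
    show "(\<lambda>x. complex_of_real (x $ j)) \<in> borel_measurable borel"
      by (intro borel_measurable_continuous_onI continuous_intros)
    show "norm (complex_of_real (x $ j)) \<le> (1 + norm x) ^ 1" for x
      using component_le_norm_cart[of x j] by simp
  qed
  have \<psi>2: "integrable lborel (\<lambda>x. (norm x)\<^sup>2 *\<^sub>R \<psi> x)"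
    unfolding scaleR_conv_of_real
  proof (rule schwartz_integrable[OF S])
    show "norm (complex_of_real ((norm x)\<^sup>2)) \<le> (1 + norm x) ^ 2" for x :: "real^'n"
      unfolding norm_of_real by (simp add: power2_sum)
  qed simp
  let ?\<psi>' = "\<lambda>x. - 2 * of_real pi * \<i> * (of_real (x $ i) * \<psi> x)"
  have \<psi>': "integrable lborel ?\<psi>'"
    by (intro integrable_mult_right \<psi>1)
  have eq: "2 * of_real pi * \<i> * of_real (x $ i) * fourier f x * \<psi> x = - (fourier f x * ?\<psi>' x)" for x
    by simp
  show "integrable lborel (\<lambda>x. 2 * of_real pi * \<i> * of_real (x $ i) * fourier f x * \<psi> x)"
    unfolding eq by (intro integrable_minus integrable_fourier_times f \<psi>')
  have "partial i (fourier \<psi>) = fourier ?\<psi>'"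
    by (rule ext) (rule partial_fourier[OF \<psi> \<psi>2 \<psi>1])
  then have "distr_fourier (distr_deriv i (distr_of f)) \<psi> = - (LINT x|lborel. f x * fourier ?\<psi>' x)"
    by (simp only: distr_fourier_def distr_deriv_def distr_of_def)
  also have "\<dots> = distr_of (\<lambda>x. 2 * of_real pi * \<i> * of_real (x $ i) * fourier f x) \<psi>"
    unfolding distr_of_def eq integral_times_fourier[OF f \<psi>'] by simp
  finally show "distr_fourier (distr_deriv i (distr_of f)) \<psi> =
    distr_of (\<lambda>x. 2 * of_real pi * \<i> * of_real (x $ i) * fourier f x) \<psi>" .
qed

lemma distr_is_fun_diff:
  assumes "distr_is_fun S f" "distr_is_fun T g"
  shows "distr_is_fun (distr_diff S T) (\<lambda>x. f x - g x)"
  using assms unfolding distr_is_fun_def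
  by (auto simp: distr_diff_def distr_of_def left_diff_distrib intro!: continuous_intros)

lemma distr_is_fun_mean:
  assumes "distr_is_fun S f" "distr_is_fun T g"
  shows "distr_is_fun (\<lambda>\<psi>. (S \<psi> + T \<psi>) / 2) (\<lambda>x. (f x + g x) / 2)"
  using assms unfolding distr_is_fun_def
  by (auto simp: distr_of_def distrib_right intro!: continuous_intros)

lemma distr_fourier_diff:
  "distr_fourier (distr_diff S T) = distr_diff (distr_fourier S) (distr_fourier T)"
  by (simp add: fun_eq_iff distr_fourier_def distr_diff_def)

lemma distr_is_fun_fourier_sym_grad:
  assumes "\<And>i. integrable lborel (\<lambda>x. p x $ i)"
  shows "distr_is_fun (distr_fourier (sym_grad p i j))
    (\<lambda>\<xi>. (2 * of_real pi * \<i> * of_real (\<xi> $ j) * fourier (\<lambda>x. p x $ i) \<xi> +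
          2 * of_real pi * \<i> * of_real (\<xi> $ i) * fourier (\<lambda>x. p x $ j) \<xi>) / 2)"
proof -
  have "distr_fourier (sym_grad p i j) =
    (\<lambda>\<psi>. (distr_fourier (distr_deriv j (distr_of (\<lambda>x. p x $ i))) \<psi> +
          distr_fourier (distr_deriv i (distr_of (\<lambda>x. p x $ j))) \<psi>) / 2)"
    by (simp add: fun_eq_iff distr_fourier_def sym_grad_def)
  then show ?thesis
    by (simp only: distr_is_fun_mean[OF distr_is_fun_fourier_deriv[OF assms] distr_is_fun_fourier_deriv[OF assms]])
qed

lemma fourier_sum:
  assumes "\<And>j. j \<in> A \<Longrightarrow> integrable lborel (f j)"
  shows "fourier (\<lambda>x. \<Sum>j\<in>A. f j x) \<xi> = (\<Sum>j\<in>A. fourier (f j) \<xi>)"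
  unfolding fourier_eq sum_distrib_right
  by (intro Bochner_Integration.integral_sum integrable_times_char_exp assms)

section \<open>Annihilation by trigonometric polynomials\<close>

lemma integrable_continuous_times_indicator:
  fixes f :: "'a::euclidean_space \<Rightarrow> complex"
  assumes f: "continuous_on UNIV f" and "bounded S" and "S \<in> sets borel"
  shows "integrable lborel (\<lambda>x. f x * indicator S x)"
proof -
  obtain b where b: "S \<subseteq> cbox (- b) b"
    using bounded_subset_cbox_symmetric[OF \<open>bounded S\<close>] by blast
  have "set_integrable lborel (cbox (- b) b) f"
    unfolding set_integrable_def
    by (intro borel_integrable_compact continuous_on_subset[OF f]) auto
  then have "set_integrable lborel S f"
    by (rule set_integrable_subset) (use b \<open>S \<in> sets borel\<close> in auto)
  moreover have "indicator S x *\<^sub>R f x = f x * indicator S x" for x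
    by (simp add: indicator_def)
  ultimately show ?thesis
    by (simp add: set_integrable_def)
qed

section \<open>A single affine piece\<close>

text \<open>This covers the pieces of \<open>u\<close> and, with \<open>b = 0\<close>, the constant
  pieces of \<open>p\<close>, so that one lemma serves both equations.\<close>

definition affine_form :: "complex^'n::finite \<Rightarrow> complex \<Rightarrow> real^'n \<Rightarrow> complex" where
  "affine_form b c x = (\<Sum>i\<in>UNIV. b $ i * of_real (x $ i)) + c"

lemma continuous_on_affine_form: "continuous_on S (affine_form b c)"
  unfolding affine_form_def[abs_def] by (intro continuous_intros)

lemma affine_form_add_axis: "affine_form b c (x + t *\<^sub>R axis i 1) = affine_form b c x + of_real t * b $ i"
proof -
  have "(\<Sum>j\<in>UNIV. b $ j * of_real (t * axis i 1 $ j)) = of_real t * b $ i"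
    by (simp add: axis_def if_distrib cong: if_cong)
  then show ?thesis
    by (simp add: affine_form_def distrib_left sum.distrib)
qed

text \<open>The \<open>k\<close>-th summand is minus the integral over \<open>\<Omega>\<close> of
  the \<open>i\<close>-th partial derivative of \<open>a k\<close> times the affine form times the
  exponential of frequency \<open>\<xi> + real_vec k\<close>. The two terms of the product rule give
  the two Fourier transforms. Vanishing on the frontier is known for the sum over \<open>k\<close>
  and not for its terms, so the sum is formed before integrating.\<close>

lemma annihilate_affine_indicator:
  fixes \<Omega> :: "(real^'n::finite) set"
  assumes \<Omega>: "open \<Omega>" "bounded \<Omega>" and zero: "\<And>x. x \<in> frontier \<Omega> \<Longrightarrow> trig_poly K a x = 0"
  shows "(\<Sum>k\<in>K. (2 * of_real pi * \<i> * of_real ((\<xi> + real_vec k) $ i) *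
              fourier (\<lambda>x. affine_form b c x * indicator \<Omega> x) (\<xi> + real_vec k)
            - fourier (\<lambda>x. b $ i * indicator \<Omega> x) (\<xi> + real_vec k)) * a k) = 0"
proof -
  let ?L = "affine_form b c"
  \<comment> \<open>The factor that differentiation along the \<open>i\<close>-th axis brings down
    from \<open>E k\<close>.\<close>
  define z where "z k = - 2 * of_real pi * \<i> * of_real ((\<xi> + real_vec k) $ i)" for k
  define E where "E k = char_exp (\<xi> + real_vec k)" for k
  define g where "g x = (\<Sum>k\<in>K. a k * (?L x * E k x))" for x
  define D where "D x = (\<Sum>k\<in>K. a k * ((b $ i + z k * ?L x) * E k x))" for x
  have contE: "continuous_on UNIV (E k)" for k
    unfolding E_def by (intro continuous_intros)
  have cont: "continuous_on UNIV g" "continuous_on UNIV D"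
    unfolding g_def[abs_def] D_def[abs_def]
    by (intro continuous_intros continuous_on_affine_form contE)+
  have meas: "\<Omega> \<in> sets borel" using \<Omega> by simp
  have int: "integrable lborel (\<lambda>x. f x * indicator \<Omega> x)" if "continuous_on UNIV f" for f :: "real^'n \<Rightarrow> complex"
    using integrable_continuous_times_indicator[OF that \<Omega>(2) meas] .
  have comm: "indicator \<Omega> x *\<^sub>R w = w * indicator \<Omega> x" for x and w :: complex
    by (simp add: indicator_def)
  have "(LINT x|lborel. indicator \<Omega> x *\<^sub>R D x) = 0"
  proof (rule lborel_integral_indicator_derivative_eq_0[OF \<Omega>(1), where v = "axis i 1"])
    fix x
    have E: "E k (x + t *\<^sub>R axis i 1) = E k x * exp (t *\<^sub>R z k)" for k t
      unfolding scaleR_conv_of_real[of t "z k"]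
      by (simp add: E_def z_def char_exp_def inner_add_right inner_axis algebra_simps flip: exp_add)
    have "((\<lambda>t. a k * ((?L x + of_real t * b $ i) * (E k x * exp (t *\<^sub>R z k)))) has_vector_derivative
        a k * ((b $ i + z k * ?L x) * E k x)) (at 0)" for k
    proof -
      have "((\<lambda>t. (?L x + of_real t * b $ i) * (E k x * exp (t *\<^sub>R z k))) has_vector_derivative
         (?L x + of_real 0 * b $ i) * (E k x * (exp (0 *\<^sub>R z k) * z k)) + (0 + 1 * b $ i) * (E k x * exp (0 *\<^sub>R z k))) (at 0)"
        by (intro has_vector_derivative_mult has_vector_derivative_mult_right
            has_vector_derivative_mult_left has_vector_derivative_add
            has_vector_derivative_const exp_scaleR_has_vector_derivative_right)
          (use has_vector_derivative_of_real[OF DERIV_ident] in simp)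
      from has_vector_derivative_mult_right[OF this, of "a k"] show ?thesis
        by (simp add: algebra_simps)
    qed
    then show "((\<lambda>t. g (x + t *\<^sub>R axis i 1)) has_vector_derivative D x) (at 0)"
      unfolding g_def D_def affine_form_add_axis E by (intro has_vector_derivative_sum)
  next
    show "integrable lborel (\<lambda>x. indicator \<Omega> x *\<^sub>R g x)" "integrable lborel (\<lambda>x. indicator \<Omega> x *\<^sub>R D x)"
      unfolding comm by (intro int cont)+
  next
    fix x assume "x \<in> frontier \<Omega>"
    \<comment> \<open>All \<open>E k\<close> share the factor \<open>char_exp \<xi>\<close>; what
      remains of the sum is the trigonometric polynomial.\<close>
    have "g x = ?L x * char_exp \<xi> x * trig_poly K a x"
      by (simp add: g_def trig_poly_eq E_def char_exp_add sum_distrib_left mult_ac)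
    then show "g x = 0"
      using zero[OF \<open>x \<in> frontier \<Omega>\<close>] by simp
  qed (rule cont)
  moreover have "(LINT x|lborel. indicator \<Omega> x *\<^sub>R D x) =
     (\<Sum>k\<in>K. LINT x|lborel. a k * ((b $ i + z k * ?L x) * E k x) * indicator \<Omega> x)"
    unfolding comm D_def sum_distrib_right
    by (intro Bochner_Integration.integral_sum int continuous_intros continuous_on_affine_form contE)
  moreover have "(LINT x|lborel. a k * ((b $ i + z k * ?L x) * E k x) * indicator \<Omega> x) =
     - ((- z k * fourier (\<lambda>x. ?L x * indicator \<Omega> x) (\<xi> + real_vec k)
       - fourier (\<lambda>x. b $ i * indicator \<Omega> x) (\<xi> + real_vec k)) * a k)" for k
  proof -
    have "(LINT x|lborel. a k * ((b $ i + z k * ?L x) * E k x) * indicator \<Omega> x) =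
      (LINT x|lborel. a k * (b $ i * indicator \<Omega> x * E k x) + a k * z k * (?L x * indicator \<Omega> x * E k x))"
      by (simp add: algebra_simps)
    also have "\<dots> = (LINT x|lborel. a k * (b $ i * indicator \<Omega> x * E k x)) +
       (LINT x|lborel. a k * z k * (?L x * indicator \<Omega> x * E k x))"
      unfolding E_def
      by (intro Bochner_Integration.integral_add integrable_mult_right integrable_times_char_exp
          int continuous_on_affine_form continuous_on_const)
    also have "\<dots> = a k * fourier (\<lambda>x. b $ i * indicator \<Omega> x) (\<xi> + real_vec k) +
       a k * z k * fourier (\<lambda>x. ?L x * indicator \<Omega> x) (\<xi> + real_vec k)"
      unfolding integral_mult_right_zero fourier_eq E_def ..
    finally show ?thesis by (simp add: algebra_simps)
  qed
  ultimately show ?thesis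
    by (simp add: sum_negf z_def)
qed

theorem theorem2p1:
  fixes u :: "real^2 \<Rightarrow> complex"
    and J :: nat
    and \<alpha> :: "nat \<Rightarrow> complex^2"
    and \<beta> :: "nat \<Rightarrow> complex"
    and \<Omega> :: "nat \<Rightarrow> (real^2) set"
    and K :: "(int^2) set"
    and a :: "int^2 \<Rightarrow> complex"
  assumes "minimal_pw_linear_rep u J \<alpha> \<beta> \<Omega>"
    and "finite K" and "rectangular K" and "uminus ` K = K"
    and "(\<Union>j\<in>{1..J}. frontier (\<Omega> j)) \<subseteq> {x. trig_poly K a x = 0}"
  shows "\<exists>p :: real^2 \<Rightarrow> complex^2.
    (\<forall>i. integrable lborel (\<lambda>x. p x $ i)) \<and>
    (\<forall>i. \<exists>G. distr_is_fun
               (distr_fourier (distr_diff (distr_deriv i (distr_of u)) (distr_of (\<lambda>x. p x $ i)))) G \<and>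
             (\<forall>\<xi>. (\<Sum>k\<in>K. G (\<xi> + real_vec k) * a k) = 0)) \<and>
    (\<forall>i j. \<exists>H. distr_is_fun (distr_fourier (sym_grad p i j)) H \<and>
               (\<forall>\<xi>. (\<Sum>k\<in>K. H (\<xi> + real_vec k) * a k) = 0))"
proof -
  have rep: "pw_linear_rep u J \<alpha> \<beta> \<Omega>"
    using assms(1) by (simp add: minimal_pw_linear_rep_def)
  define unit_square :: "(real^2) set" where "unit_square = {x. \<forall>i. - 1/2 \<le> x $ i \<and> x $ i < 1/2}"
  have "unit_square \<subseteq> cbox (\<chi> i. - 1/2) (\<chi> i. 1/2)"
    by (auto simp: unit_square_def mem_box_cart less_imp_le)
  then have "bounded unit_square"
    by (rule bounded_subset[OF bounded_cbox])
  have \<Omega>: "open (\<Omega> j)" "bounded (\<Omega> j)" "\<And>x. x \<in> frontier (\<Omega> j) \<Longrightarrow> trig_poly K a x = 0"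
    if "j \<in> {1..J}" for j
  proof -
    have "open (\<Omega> j) \<and> \<Omega> j \<subseteq> unit_square"
      using rep that by (simp add: pw_linear_rep_def unit_square_def)
    then show "open (\<Omega> j)" "bounded (\<Omega> j)"
      using bounded_subset[OF \<open>bounded unit_square\<close>] by blast+
    show "trig_poly K a x = 0" if "x \<in> frontier (\<Omega> j)" for x
    proof -
      have "x \<in> (\<Union>j\<in>{1..J}. frontier (\<Omega> j))" using that \<open>j \<in> {1..J}\<close> by blast
      then show ?thesis using assms(5) by blast
    qed
  qed
  have int: "integrable lborel (\<lambda>x. f x * indicator (\<Omega> j) x)"
    if "j \<in> {1..J}" "continuous_on UNIV f" for j and f :: "real^2 \<Rightarrow> complex"
    using that \<Omega> by (intro integrable_continuous_times_indicator) auto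
  have u: "u = (\<lambda>x. \<Sum>j=1..J. affine_form (\<alpha> j) (\<beta> j) x * indicator (\<Omega> j) x)"
    using rep by (auto simp: pw_linear_rep_def affine_form_def)
  have int_u: "integrable lborel u"
    unfolding u by (intro Bochner_Integration.integrable_sum int continuous_on_affine_form)
  \<comment> \<open>On each piece \<open>p\<close> is the gradient of \<open>u\<close>, and it is
    \<open>0\<close> outside the pieces, so the gradient of \<open>u\<close> minus \<open>p\<close>
    is supported by the singularity set.\<close>
  define p where "p x = (\<chi> i. \<Sum>j=1..J. \<alpha> j $ i * indicator (\<Omega> j) x)" for x
  have p: "(\<lambda>x. p x $ i) = (\<lambda>x. \<Sum>j=1..J. \<alpha> j $ i * indicator (\<Omega> j) x)" for i
    by (simp add: p_def)
  have int_p: "integrable lborel (\<lambda>x. p x $ i)" for i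
    unfolding p by (intro Bochner_Integration.integrable_sum int continuous_on_const)
  have fourier_u: "fourier u \<xi> = (\<Sum>j=1..J. fourier (\<lambda>x. affine_form (\<alpha> j) (\<beta> j) x * indicator (\<Omega> j) x) \<xi>)" for \<xi>
    unfolding u by (intro fourier_sum int continuous_on_affine_form)
  have fourier_p: "fourier (\<lambda>x. p x $ i) \<xi> = (\<Sum>j=1..J. fourier (\<lambda>x. \<alpha> j $ i * indicator (\<Omega> j) x) \<xi>)" for i \<xi>
    unfolding p by (intro fourier_sum int continuous_on_const)
  let ?m = "\<lambda>\<xi> i. 2 * of_real pi * \<i> * of_real (\<xi> $ i) :: complex"
  have grad: "(\<Sum>k\<in>K. (?m (\<xi> + real_vec k) i * fourier u (\<xi> + real_vec k)
      - fourier (\<lambda>x. p x $ i) (\<xi> + real_vec k)) * a k) = 0" for \<xi> i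
  proof -
    have "(\<Sum>k\<in>K. (?m (\<xi> + real_vec k) i * fourier u (\<xi> + real_vec k)
      - fourier (\<lambda>x. p x $ i) (\<xi> + real_vec k)) * a k) =
      (\<Sum>k\<in>K. \<Sum>j=1..J. (?m (\<xi> + real_vec k) i *
          fourier (\<lambda>x. affine_form (\<alpha> j) (\<beta> j) x * indicator (\<Omega> j) x) (\<xi> + real_vec k)
      - fourier (\<lambda>x. \<alpha> j $ i * indicator (\<Omega> j) x) (\<xi> + real_vec k)) * a k)"
      by (simp only: fourier_u fourier_p sum_distrib_left sum_distrib_right sum_subtractf[symmetric])
    also have "\<dots> = (\<Sum>j=1..J. \<Sum>k\<in>K. (?m (\<xi> + real_vec k) i *
          fourier (\<lambda>x. affine_form (\<alpha> j) (\<beta> j) x * indicator (\<Omega> j) x) (\<xi> + real_vec k)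
      - fourier (\<lambda>x. \<alpha> j $ i * indicator (\<Omega> j) x) (\<xi> + real_vec k)) * a k)"
      by (rule sum.swap)
    also have "\<dots> = 0"
    proof (rule sum.neutral, rule ballI)
      fix j assume "j \<in> {1..J}"
      from annihilate_affine_indicator[OF \<Omega>[OF this]]
      show "(\<Sum>k\<in>K. (?m (\<xi> + real_vec k) i *
          fourier (\<lambda>x. affine_form (\<alpha> j) (\<beta> j) x * indicator (\<Omega> j) x) (\<xi> + real_vec k)
        - fourier (\<lambda>x. \<alpha> j $ i * indicator (\<Omega> j) x) (\<xi> + real_vec k)) * a k) = 0" .
    qed
    finally show ?thesis .
  qed
  \<comment> \<open>Every single derivative of every component of \<open>p\<close> is annihilated;
    the entries of the symmetric gradient are means of two of these.\<close>
  have sym: "(\<Sum>k\<in>K. ?m (\<xi> + real_vec k) i * fourier (\<lambda>x. p x $ l) (\<xi> + real_vec k) * a k) = 0" for \<xi> i l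
  proof -
    have "(\<Sum>k\<in>K. ?m (\<xi> + real_vec k) i * fourier (\<lambda>x. p x $ l) (\<xi> + real_vec k) * a k) =
      (\<Sum>k\<in>K. \<Sum>j=1..J. ?m (\<xi> + real_vec k) i *
          fourier (\<lambda>x. \<alpha> j $ l * indicator (\<Omega> j) x) (\<xi> + real_vec k) * a k)"
      by (simp only: fourier_p sum_distrib_left sum_distrib_right)
    also have "\<dots> = (\<Sum>j=1..J. \<Sum>k\<in>K. ?m (\<xi> + real_vec k) i *
          fourier (\<lambda>x. \<alpha> j $ l * indicator (\<Omega> j) x) (\<xi> + real_vec k) * a k)"
      by (rule sum.swap)
    also have "\<dots> = 0"
    proof (rule sum.neutral, rule ballI)
      fix j assume "j \<in> {1..J}"
      \<comment> \<open>With linear part \<open>0\<close> and constant \<open>\<alpha> j $ l\<close>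
        the affine form is a constant piece of \<open>p $ l\<close>, and the subtracted transform is
        that of the zero function.\<close>
      from annihilate_affine_indicator[OF \<Omega>[OF this], of \<xi> i 0 "\<alpha> j $ l"]
      show "(\<Sum>k\<in>K. ?m (\<xi> + real_vec k) i *
          fourier (\<lambda>x. \<alpha> j $ l * indicator (\<Omega> j) x) (\<xi> + real_vec k) * a k) = 0"
        by (simp add: affine_form_def fourier_eq[of "\<lambda>x. 0"])
    qed
    finally show ?thesis .
  qed
  show ?thesis
  proof (intro exI[of _ p] conjI allI)
    show "integrable lborel (\<lambda>x. p x $ i)" for i
      by (rule int_p)
    show "\<exists>G. distr_is_fun
               (distr_fourier (distr_diff (distr_deriv i (distr_of u)) (distr_of (\<lambda>x. p x $ i)))) G \<and>
             (\<forall>\<xi>. (\<Sum>k\<in>K. G (\<xi> + real_vec k) * a k) = 0)" for i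
      using distr_is_fun_diff[OF distr_is_fun_fourier_deriv[OF int_u] distr_is_fun_fourier[OF int_p]] grad
      unfolding distr_fourier_diff by blast
    show "\<exists>H. distr_is_fun (distr_fourier (sym_grad p i j)) H \<and>
               (\<forall>\<xi>. (\<Sum>k\<in>K. H (\<xi> + real_vec k) * a k) = 0)" for i j
    proof (intro exI conjI allI)
      show "distr_is_fun (distr_fourier (sym_grad p i j))
        (\<lambda>\<xi>. (?m \<xi> j * fourier (\<lambda>x. p x $ i) \<xi> + ?m \<xi> i * fourier (\<lambda>x. p x $ j) \<xi>) / 2)"
        by (rule distr_is_fun_fourier_sym_grad[OF int_p])
      fix \<xi>
      have "(\<Sum>k\<in>K. (?m (\<xi> + real_vec k) j * fourier (\<lambda>x. p x $ i) (\<xi> + real_vec k) +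
           ?m (\<xi> + real_vec k) i * fourier (\<lambda>x. p x $ j) (\<xi> + real_vec k)) / 2 * a k) =
         ((\<Sum>k\<in>K. ?m (\<xi> + real_vec k) j * fourier (\<lambda>x. p x $ i) (\<xi> + real_vec k) * a k) +
          (\<Sum>k\<in>K. ?m (\<xi> + real_vec k) i * fourier (\<lambda>x. p x $ j) (\<xi> + real_vec k) * a k)) / 2"
        by (simp only: sum.distrib[symmetric] sum_divide_distrib distrib_right times_divide_eq_left add_divide_distrib)
      then show "(\<Sum>k\<in>K. (?m (\<xi> + real_vec k) j * fourier (\<lambda>x. p x $ i) (\<xi> + real_vec k) +
           ?m (\<xi> + real_vec k) i * fourier (\<lambda>x. p x $ j) (\<xi> + real_vec k)) / 2 * a k) = 0"
        unfolding sym by simp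
    qed
  qed
qed

end
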